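(* For a block matrix $\begin{pmatrix} A & B\\ C& D\end{pmatrix}\in\mathfrak{gl}_{2n}(\mathbb{C})$ (with $n\times n$ blocks) and $a\in U(\mathfrak{gl}_n)$ put $$\begin{pmatrix} A & B\\ C& D\end{pmatrix}\cdot a = Aa-aD+\mathrm{tr}(\psi(a).B^{T})-\mathrm{tr}(\varphi(a).F_2.C)-\mathrm{tr}(\varphi(a).C)\,\mathrm{tr}(F).$$ This defines a $\mathfrak{gl}_{2n}(\mathbb{C})$-module structure on $U(\mathfrak{gl}_n)$.
   Context: Everything is over $\mathbb{C}$. Let $\mathcal{A}=\mathfrak{gl}_n$ (identified with the top-left block subalgebra of $\mathfrak{gl}_{2n}$), with matrix units $e_{i,j}$, $1\le i,j\le n$; also write $\mathcal{A}$ for the associative algebra $\mathrm{Mat}_{n\times n}(\mathbb{C})$. Let $U(\mathcal{A})\otimes_{\mathbb{C}}\mathcal{A}\simeq \mathrm{Mat}_{n\times n}(U(\mathcal{A}))$ be the tensor product of unital associative algebras, with product written with a dot; a matrix $X\in\mathcal{A}$ is identified with $1\otimes X$ inside it. Juxtaposition denotes the product in $U(\mathcal{A})$; in the terms $Aa$ and $aD$, the matrices $A,D$ are regarded as elements of $\mathfrak{gl}_n\subset U(\mathfrak{gl}_n)$. The trace is the linear map $\mathrm{tr}:U(\mathcal{A})\otimes\mathcal{A}\to U(\mathcal{A})$, $\mathrm{tr}(a\otimes X)=a\,\mathrm{tr}(X)$. The algebra homomorphisms $\varphi,\psi:U(\mathcal{A})\to U(\mathcal{A})\otimes\mathcal{A}$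 are the extensions of the Lie algebra homomorphisms $\varphi(X)=X\otimes I+1\otimes X$ and $\psi(X)=X\otimes I-1\otimes X^{T}$ for $X\in\mathcal{A}$. Put $F=\sum_{i,j}e_{j,i}\otimes e_{i,j}$, so that $\mathrm{tr}(F)=\sum_i e_{i,i}\in U(\mathcal{A})$, and $F_2=\sum_{i,j,r=1}^{n}e_{i,r}e_{r,j}\otimes e_{j,i}\in U(\mathcal{A})\otimes\mathcal{A}$, so that $\mathrm{tr}(e_{i,j}.F_2)=\sum_{r}e_{i,r}e_{r,j}$. *)

theory Defs
  imports "HOL-Analysis.Analysis" "HOL-Library.Poly_Mapping"
begin

text \<open>Words form a monoid under concatenation, so that finitely supported functions on words,
  with the convolution product of \<open>HOL-Library.Poly_Mapping\<close>, are the free associative algebra.\<close>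

instantiation list :: (type) monoid_add
begin

definition zero_list :: "'a list" where "zero_list = []"
definition plus_list :: "'a list \<Rightarrow> 'a list \<Rightarrow> 'a list" where "plus_list = (@)"

instance by standard (simp_all add: zero_list_def plus_list_def)

end


definition gl_bracket :: "'a::ring_1^'m^'m \<Rightarrow> 'a^'m^'m \<Rightarrow> 'a^'m^'m" where
  "gl_bracket X Y = X ** Y - Y ** X"

definition mat_unit :: "'n \<Rightarrow> 'n \<Rightarrow> complex^'n^'n" where
  "mat_unit i j = (\<chi> k l. if k = i \<and> l = j then 1 else 0)"

text \<open>A representation of \<open>gl\<close> with index type \<open>'m\<close> on the complex vector space given by the
  scalar multiplication \<open>smul\<close>.\<close>

definition gl_module ::
  "(complex \<Rightarrow> 'v::ab_group_add \<Rightarrow> 'v) \<Rightarrow> (complex^'m^'m \<Rightarrow> 'v \<Rightarrow> 'v) \<Rightarrow> bool" where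
  "gl_module smul act \<longleftrightarrow>
     vector_space smul \<and>
     (\<forall>v. Vector_Spaces.linear (\<lambda>c. map_matrix ((*) c)) smul (\<lambda>X. act X v)) \<and>
     (\<forall>X. Vector_Spaces.linear smul smul (act X)) \<and>
     (\<forall>X Y v. act (gl_bracket X Y) v = act X (act Y v) - act Y (act X v))"


text \<open>The tensor algebra of \<open>gl\<^sub>n\<close>, written in the basis of matrix units: the word
  \<open>[(i\<^sub>1,j\<^sub>1), \<dots>, (i\<^sub>k,j\<^sub>k)]\<close> stands for the tensor product of the corresponding matrix units.\<close>

type_synonym 'n gl_tensor = "('n \<times> 'n) list \<Rightarrow>\<^sub>0 complex"

definition gl_tensor_of :: "complex^'n^'n \<Rightarrow> 'n::finite gl_tensor" where
  "gl_tensor_of X = (\<Sum>i\<in>UNIV. \<Sum>j\<in>UNIV. Poly_Mapping.single [(i, j)] (X $ i $ j))"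

text \<open>The two-sided ideal generated by the elements \<open>X \<otimes> Y - Y \<otimes> X - [X,Y]\<close>.\<close>

inductive_set enveloping_ideal :: "'n::finite gl_tensor set" where
  generator: "a * (gl_tensor_of X * gl_tensor_of Y - gl_tensor_of Y * gl_tensor_of X
                - gl_tensor_of (gl_bracket X Y)) * b \<in> enveloping_ideal"
| add: "p \<in> enveloping_ideal \<Longrightarrow> q \<in> enveloping_ideal \<Longrightarrow> p + q \<in> enveloping_ideal"

lemma enveloping_ideal_0: "0 \<in> enveloping_ideal"
  using enveloping_ideal.generator[of 0] by simp

lemma enveloping_ideal_mult_left: "p \<in> enveloping_ideal \<Longrightarrow> c * p \<in> enveloping_ideal"
proof (induction rule: enveloping_ideal.induct)
  case (generator a X Y b)
  then show ?case
    using enveloping_ideal.generator[of "c * a" X Y b] by (simp add: mult.assoc)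
next
  case (add p q)
  then show ?case by (simp add: distrib_left enveloping_ideal.add)
qed

lemma enveloping_ideal_mult_right: "p \<in> enveloping_ideal \<Longrightarrow> p * c \<in> enveloping_ideal"
proof (induction rule: enveloping_ideal.induct)
  case (generator a X Y b)
  then show ?case
    using enveloping_ideal.generator[of a X Y "b * c"] by (simp add: mult.assoc)
next
  case (add p q)
  then show ?case by (simp add: distrib_right enveloping_ideal.add)
qed

lemma enveloping_ideal_uminus: "p \<in> enveloping_ideal \<Longrightarrow> - p \<in> enveloping_ideal"
  using enveloping_ideal_mult_left[of p "- 1"] by simp

lemma enveloping_ideal_diff:
  "p \<in> enveloping_ideal \<Longrightarrow> q \<in> enveloping_ideal \<Longrightarrow> p - q \<in> enveloping_ideal"
  using enveloping_ideal.add[OF _ enveloping_ideal_uminus, of p q] by simp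

lemma poly_mapping_additive_induct [case_names zero add single]:
  fixes p :: "'a \<Rightarrow>\<^sub>0 'b::comm_monoid_add"
  assumes "P 0" and "\<And>p q. P p \<Longrightarrow> P q \<Longrightarrow> P (p + q)"
    and "\<And>w c. P (Poly_Mapping.single w c)"
  shows "P p"
proof -
  have eq: "p = (\<Sum>w\<in>Poly_Mapping.keys p. Poly_Mapping.single w (Poly_Mapping.lookup p w))"
    by (rule poly_mapping_eqI)
       (auto simp: lookup_sum lookup_single when_def in_keys_iff)
  have "P (\<Sum>w\<in>A. Poly_Mapping.single w (Poly_Mapping.lookup p w))" if "finite A" for A
    using that by induction (auto intro: assms)
  then show ?thesis using eq finite_keys by metis
qed

lemma lookup_0_mult:
  fixes p q :: "'a list \<Rightarrow>\<^sub>0 'b::ring_1"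
  shows "Poly_Mapping.lookup (p * q) 0 = Poly_Mapping.lookup p 0 * Poly_Mapping.lookup q 0"
proof (induction p rule: poly_mapping_additive_induct)
  case (single w c)
  show ?case
    by (induction q rule: poly_mapping_additive_induct)
       (auto simp: distrib_left lookup_add mult_single lookup_single when_def
          zero_list_def plus_list_def)
qed (simp_all add: distrib_right lookup_add)

lemma lookup_0_gl_tensor_of: "Poly_Mapping.lookup (gl_tensor_of X) 0 = 0"
  by (simp add: gl_tensor_of_def lookup_sum lookup_single zero_list_def)

lemma lookup_0_enveloping_ideal: "p \<in> enveloping_ideal \<Longrightarrow> Poly_Mapping.lookup p 0 = 0"
  by (induction rule: enveloping_ideal.induct)
     (simp_all add: lookup_0_mult lookup_minus lookup_add lookup_0_gl_tensor_of)

lemma one_notin_enveloping_ideal: "1 \<notin> enveloping_ideal"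
  using lookup_0_enveloping_ideal[of 1] by (auto simp: lookup_one)


text \<open>The universal enveloping algebra of \<open>gl\<^sub>n\<close>.\<close>

quotient_type 'n U_gl = "'n::finite gl_tensor" / "\<lambda>p q. p - q \<in> enveloping_ideal"
proof (rule equivpI)
  show "reflp (\<lambda>p q. p - q \<in> enveloping_ideal)"
    by (simp add: reflp_def enveloping_ideal_0)
  show "symp (\<lambda>p q. p - q \<in> enveloping_ideal)"
    using enveloping_ideal_uminus by (fastforce simp: symp_def)
  show "transp (\<lambda>p q. p - q \<in> enveloping_ideal)"
    using enveloping_ideal.add by (fastforce simp: transp_def)
qed

instantiation U_gl :: (finite) ring_1
begin

lift_definition zero_U_gl :: "'a U_gl" is 0 .
lift_definition one_U_gl :: "'a U_gl" is 1 .
lift_definition plus_U_gl :: "'a U_gl \<Rightarrow> 'a U_gl \<Rightarrow> 'a U_gl" is "(+)"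
  by (metis enveloping_ideal.add add_diff_add)
lift_definition minus_U_gl :: "'a U_gl \<Rightarrow> 'a U_gl \<Rightarrow> 'a U_gl" is "(-)"
proof -
  fix p q r s :: "'a gl_tensor"
  assume "p - q \<in> enveloping_ideal" "r - s \<in> enveloping_ideal"
  then have "(p - q) - (r - s) \<in> enveloping_ideal" by (rule enveloping_ideal_diff)
  then show "p - r - (q - s) \<in> enveloping_ideal" by (simp add: algebra_simps)
qed
lift_definition uminus_U_gl :: "'a U_gl \<Rightarrow> 'a U_gl" is uminus
  using enveloping_ideal_uminus by (metis minus_diff_minus)
lift_definition times_U_gl :: "'a U_gl \<Rightarrow> 'a U_gl \<Rightarrow> 'a U_gl" is "(*)"
proof -
  fix p q r s :: "'a gl_tensor"
  assume "p - q \<in> enveloping_ideal" "r - s \<in> enveloping_ideal"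
  then have "(p - q) * r + q * (r - s) \<in> enveloping_ideal"
    by (intro enveloping_ideal.add enveloping_ideal_mult_left enveloping_ideal_mult_right)
  then show "p * r - q * s \<in> enveloping_ideal" by (simp add: algebra_simps)
qed

instance
proof
  fix a b c :: "'a U_gl"
  show "a + b + c = a + (b + c)"
    by transfer (simp add: add.assoc enveloping_ideal_0)
  show "a + b = b + a"
    by transfer (simp add: add.commute enveloping_ideal_0)
  show "0 + a = a"
    by transfer (simp add: enveloping_ideal_0)
  show "- a + a = 0"
    by transfer (simp add: enveloping_ideal_0)
  show "a - b = a + - b"
    by transfer (simp add: enveloping_ideal_0)
  show "a * b * c = a * (b * c)"
    by transfer (simp add: mult.assoc enveloping_ideal_0)
  show "1 * a = a" "a * 1 = a"
    by (transfer, simp add: enveloping_ideal_0)+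
  show "(a + b) * c = a * c + b * c"
    by transfer (simp add: distrib_right enveloping_ideal_0)
  show "a * (b + c) = a * b + a * c"
    by transfer (simp add: distrib_left enveloping_ideal_0)
  show "(0 :: 'a U_gl) \<noteq> 1"
    by transfer (use enveloping_ideal_uminus one_notin_enveloping_ideal in fastforce)
qed

end

text \<open>The structure maps: the unit (scalars) and the canonical map from \<open>gl\<^sub>n\<close>.\<close>

lift_definition U_const :: "complex \<Rightarrow> 'n::finite U_gl" is "Poly_Mapping.single 0" .

lift_definition U_of :: "complex^'n^'n \<Rightarrow> 'n::finite U_gl" is gl_tensor_of .

definition U_scale :: "complex \<Rightarrow> 'n::finite U_gl \<Rightarrow> 'n U_gl" where
  "U_scale c a = U_const c * a"

lemma single_0_central: "Poly_Mapping.single 0 c * p = p * Poly_Mapping.single 0 (c :: complex)"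
  for p :: "'a list \<Rightarrow>\<^sub>0 complex"
  by (induction p rule: poly_mapping_additive_induct)
     (simp_all add: distrib_left distrib_right mult_single mult.commute)

lemma U_const_central: "U_const c * a = a * U_const c"
  by transfer (simp add: single_0_central enveloping_ideal_0)

lemma U_const_add: "U_const (c + d) = U_const c + U_const d"
  by transfer (simp add: single_add enveloping_ideal_0)

lemma U_const_mult: "U_const (c * d) = U_const c * U_const d"
  by transfer (simp add: mult_single enveloping_ideal_0)

lemma U_const_0 [simp]: "U_const 0 = 0"
  by transfer (simp add: enveloping_ideal_0)

lemma U_const_1 [simp]: "U_const 1 = 1"
  by transfer (simp add: enveloping_ideal_0)

lemma U_const_diff: "U_const (c - d) = U_const c - U_const d"
  by transfer (simp add: single_diff enveloping_ideal_0)

lemma vector_space_U_scale: "vector_space U_scale"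
  by unfold_locales
     (simp_all add: U_scale_def distrib_left distrib_right U_const_add U_const_mult mult.assoc)

lemma U_scale_mult_left: "U_scale c a * b = U_scale c (a * b)"
  by (simp add: U_scale_def mult.assoc)

lemma U_scale_mult_right: "a * U_scale c b = U_scale c (a * b)"
  by (metis U_scale_def U_const_central mult.assoc)

lemma U_of_add: "U_of (X + Y) = U_of X + U_of Y"
  by transfer (simp add: gl_tensor_of_def single_add sum.distrib enveloping_ideal_0)

lemma U_of_scale: "U_of (map_matrix ((*) c) X) = U_scale c (U_of X)"
  unfolding U_scale_def
  by transfer (simp add: gl_tensor_of_def sum_distrib_left mult_single enveloping_ideal_0)

lemma U_of_bracket: "U_of (gl_bracket X Y) = U_of X * U_of Y - U_of Y * U_of X"
proof (transfer)
  fix X Y :: "complex^'n^'n"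
  show "gl_tensor_of (gl_bracket X Y) -
         (gl_tensor_of X * gl_tensor_of Y - gl_tensor_of Y * gl_tensor_of X) \<in> enveloping_ideal"
    using enveloping_ideal_uminus[OF enveloping_ideal.generator[of 1 X Y 1]] by simp
qed


text \<open>The tensor product algebra of \<open>U(gl\<^sub>n)\<close> and \<open>Mat\<^sub>n\<close> is identified with the
  algebra of matrices over \<open>U(gl\<^sub>n)\<close>, with product \<open>**\<close>. The map sending \<open>a \<otimes> X\<close> to
  \<open>tr(X) a\<close> is then the library's \<open>trace\<close>, and a scalar matrix \<open>X\<close> is \<open>U_tensor 1 X\<close>.\<close>

type_synonym 'n U_mat = "('n U_gl^'n)^'n"

definition U_tensor :: "'n::finite U_gl \<Rightarrow> complex^'n^'n \<Rightarrow> 'n U_mat" where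
  "U_tensor a X = (\<chi> i j. U_scale (X $ i $ j) a)"

definition U_alg_hom :: "('n::finite U_gl \<Rightarrow> 'n U_mat) \<Rightarrow> bool" where
  "U_alg_hom h \<longleftrightarrow>
     h 1 = mat 1 \<and> (\<forall>a b. h (a + b) = h a + h b) \<and> (\<forall>a b. h (a * b) = h a ** h b) \<and>
     (\<forall>c a. h (U_scale c a) = map_matrix (U_scale c) (h a))"

text \<open>The algebra homomorphism extending \<open>f\<close>; it exists and is unique whenever \<open>f\<close> is a Lie
  algebra homomorphism (\<open>U_extension_ex1\<close> below).\<close>

definition U_extension :: "(complex^'n^'n \<Rightarrow> 'n U_mat) \<Rightarrow> 'n::finite U_gl \<Rightarrow> 'n U_mat" where
  "U_extension f = (THE h. U_alg_hom h \<and> (\<forall>X. h (U_of X) = f X))"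

definition phi :: "'n::finite U_gl \<Rightarrow> 'n U_mat" where
  "phi = U_extension (\<lambda>X. U_tensor (U_of X) (mat 1) + U_tensor 1 X)"

definition psi :: "'n::finite U_gl \<Rightarrow> 'n U_mat" where
  "psi = U_extension (\<lambda>X. U_tensor (U_of X) (mat 1) - U_tensor 1 (transpose X))"

text \<open>\<open>F1\<close> is the element usually written \<open>F\<close>.\<close>

definition F1 :: "'n::finite U_mat" where
  "F1 = (\<Sum>i\<in>UNIV. \<Sum>j\<in>UNIV. U_tensor (U_of (mat_unit j i)) (mat_unit i j))"

definition F2 :: "'n::finite U_mat" where
  "F2 = (\<Sum>i\<in>UNIV. \<Sum>j\<in>UNIV. \<Sum>r\<in>UNIV.
           U_tensor (U_of (mat_unit i r) * U_of (mat_unit r j)) (mat_unit j i))"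

definition block_matrix ::
  "'a^'n^'n \<Rightarrow> 'a^'n^'n \<Rightarrow> 'a^'n^'n \<Rightarrow> 'a^'n^'n \<Rightarrow> 'a^('n + 'n)^('n + 'n)" where
  "block_matrix A B C D = (\<chi> p q. case (p, q) of
       (Inl i, Inl j) \<Rightarrow> A $ i $ j | (Inl i, Inr j) \<Rightarrow> B $ i $ j
     | (Inr i, Inl j) \<Rightarrow> C $ i $ j | (Inr i, Inr j) \<Rightarrow> D $ i $ j)"

definition gl2n_action :: "complex^('n + 'n)^('n + 'n) \<Rightarrow> 'n::finite U_gl \<Rightarrow> 'n U_gl" where
  "gl2n_action M a =
    (let A = (\<chi> i j. M $ Inl i $ Inl j); B = (\<chi> i j. M $ Inl i $ Inr j);
         C = (\<chi> i j. M $ Inr i $ Inl j); D = (\<chi> i j. M $ Inr i $ Inr j)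
     in U_of A * a - a * U_of D + trace (psi a ** U_tensor 1 (transpose B))
        - trace (phi a ** F2 ** U_tensor 1 C)
        - trace (phi a ** U_tensor 1 C) * trace F1)"

lemma gl2n_action_block_matrix:
  "gl2n_action (block_matrix A B C D) a =
     U_of A * a - a * U_of D + trace (psi a ** U_tensor 1 (transpose B))
     - trace (phi a ** F2 ** U_tensor 1 C)
     - trace (phi a ** U_tensor 1 C) * trace F1"
  by (simp add: gl2n_action_def block_matrix_def)


text \<open>The universal property, ensuring that \<open>phi\<close> and \<open>psi\<close> are the intended homomorphisms.\<close>

lemma U_scale_simps [simp]:
  "U_scale c 0 = 0" "U_scale 0 a = 0" "U_scale 1 a = a"
  "U_scale c (a + b) = U_scale c a + U_scale c b"
  "U_scale (c + d) a = U_scale c a + U_scale d a"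
  "U_scale c (U_scale d a) = U_scale (c * d) a"
  by (simp_all add: U_scale_def distrib_left distrib_right U_const_add U_const_mult mult.assoc)

lemma U_scale_diff [simp]:
  "U_scale c (a - b) = U_scale c a - U_scale c b"
  "U_scale (c - d) a = U_scale c a - U_scale d a"
  by (simp_all add: U_scale_def right_diff_distrib left_diff_distrib U_const_diff)

lemma U_scale_uminus [simp]: "U_scale (- c) a = - U_scale c a"
  using U_scale_diff(2)[of 0 c a] by simp

lemma U_scale_sum: "U_scale c (sum g S) = (\<Sum>x\<in>S. U_scale c (g x))"
  by (simp add: U_scale_def sum_distrib_left)

lemma U_scale_sum_left: "U_scale (sum g S) a = (\<Sum>x\<in>S. U_scale (g x) a)"
  by (induction S rule: infinite_finite_induct) simp_all

lemma map_matrix_U_scale_simps [simp]: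
  "map_matrix (U_scale c) 0 = 0" "map_matrix (U_scale 0) M = 0" "map_matrix (U_scale 1) M = M"
  "map_matrix (U_scale c) (M + N) = map_matrix (U_scale c) M + map_matrix (U_scale c) N"
  "map_matrix (U_scale (c + d)) M = map_matrix (U_scale c) M + map_matrix (U_scale d) M"
  "map_matrix (U_scale c) (map_matrix (U_scale d) M) = map_matrix (U_scale (c * d)) M"
  by (simp_all add: vec_eq_iff)

lemma map_matrix_U_scale_mult:
  "map_matrix (U_scale c) M ** N = map_matrix (U_scale c) (M ** N)"
  "M ** map_matrix (U_scale c) N = map_matrix (U_scale c) (M ** N)"
  by (simp_all add: vec_eq_iff matrix_matrix_mult_def U_scale_sum U_scale_mult_left
      U_scale_mult_right)

definition word_eval ::
  "(complex^'n^'n \<Rightarrow> 'n U_mat) \<Rightarrow> ('n::finite \<times> 'n) list \<Rightarrow> 'n U_mat" where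
  "word_eval f w = foldr (\<lambda>(i, j) M. f (mat_unit i j) ** M) w (mat 1)"

definition tensor_eval ::
  "(complex^'n^'n \<Rightarrow> 'n U_mat) \<Rightarrow> 'n::finite gl_tensor \<Rightarrow> 'n U_mat" where
  "tensor_eval f p =
     (\<Sum>w\<in>Poly_Mapping.keys p. map_matrix (U_scale (Poly_Mapping.lookup p w)) (word_eval f w))"

lemma word_eval_append: "word_eval f (u @ v) = word_eval f u ** word_eval f v"
  by (induction u) (auto simp: word_eval_def matrix_mul_assoc)

lemma tensor_eval_superset:
  assumes "finite S" "Poly_Mapping.keys p \<subseteq> S"
  shows "tensor_eval f p =
    (\<Sum>w\<in>S. map_matrix (U_scale (Poly_Mapping.lookup p w)) (word_eval f w))"
  unfolding tensor_eval_def
  by (rule sum.mono_neutral_left) (use assms in \<open>auto simp: in_keys_iff\<close>)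

lemma tensor_eval_0 [simp]: "tensor_eval f 0 = 0"
  by (simp add: tensor_eval_def)

lemma tensor_eval_add: "tensor_eval f (p + q) = tensor_eval f p + tensor_eval f q"
proof -
  let ?S = "Poly_Mapping.keys p \<union> Poly_Mapping.keys q"
  have S: "finite ?S" by simp
  show ?thesis
    using tensor_eval_superset[OF S, of p f] tensor_eval_superset[OF S, of q f]
      tensor_eval_superset[OF S, of "p + q" f] keys_add[of p q]
    by (simp add: lookup_add sum.distrib)
qed

lemma tensor_eval_uminus: "tensor_eval f (- p) = - tensor_eval f p"
  using tensor_eval_add[of f p "- p"] by (simp add: eq_neg_iff_add_eq_0 add.commute)

lemma tensor_eval_diff: "tensor_eval f (p - q) = tensor_eval f p - tensor_eval f q"
  using tensor_eval_add[of f p "- q"] by (simp add: tensor_eval_uminus)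

lemma tensor_eval_sum: "tensor_eval f (sum g S) = (\<Sum>x\<in>S. tensor_eval f (g x))"
  by (induction S rule: infinite_finite_induct) (simp_all add: tensor_eval_add)

lemma tensor_eval_single:
  "tensor_eval f (Poly_Mapping.single w c) = map_matrix (U_scale c) (word_eval f w)"
  using tensor_eval_superset[of "{w}" "Poly_Mapping.single w c" f] by simp

lemma matrix_matrix_mult_add_right:
  fixes A B :: "'a::semiring_1^'n^'m"
  shows "(A + B) ** C = A ** C + B ** C"
  by (simp add: vec_eq_iff matrix_matrix_mult_def distrib_right sum.distrib)

lemma tensor_eval_mult: "tensor_eval f (p * q) = tensor_eval f p ** tensor_eval f q"
proof (induction p rule: poly_mapping_additive_induct)
  case zero
  then show ?case by (simp add: vec_eq_iff matrix_matrix_mult_def)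
next
  case (add p p')
  then show ?case by (simp add: distrib_right tensor_eval_add matrix_matrix_mult_add_right)
next
  case (single w c)
  show ?case
  proof (induction q rule: poly_mapping_additive_induct)
    case zero
    then show ?case by (simp add: vec_eq_iff matrix_matrix_mult_def)
  next
    case (add p p')
    then show ?case by (simp add: distrib_left tensor_eval_add matrix_add_ldistrib)
  next
    case (single v d)
    then show ?case
      by (simp add: mult_single tensor_eval_single map_matrix_U_scale_mult plus_list_def
          word_eval_append mult.commute[of c d])
  qed
qed

lemma mat_unit_decomposition:
  "X = (\<Sum>i\<in>UNIV. \<Sum>j\<in>UNIV. map_matrix ((*) (X $ i $ j)) (mat_unit i j))"
proof -
  have "(\<Sum>i\<in>UNIV. \<Sum>j\<in>UNIV. X $ i $ j * (if k = i \<and> l = j then 1 else 0)) = X $ k $ l" for k l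
  proof -
    have "(\<Sum>j\<in>UNIV. X $ i $ j * (if k = i \<and> l = j then 1 else 0))
        = (if i = k then X $ k $ l else 0)" for i
      by (cases "i = k") (simp_all add: if_distrib cong: if_cong)
    then show ?thesis by simp
  qed
  then show ?thesis by (simp add: vec_eq_iff mat_unit_def)
qed

lemma gl_linear_sum_units:
  fixes f :: "complex^'n^'n \<Rightarrow> 'n::finite U_mat"
  assumes add: "\<And>X Y. f (X + Y) = f X + f Y"
    and scale: "\<And>c X. f (map_matrix ((*) c) X) = map_matrix (U_scale c) (f X)"
  shows "f X = (\<Sum>i\<in>UNIV. \<Sum>j\<in>UNIV. map_matrix (U_scale (X $ i $ j)) (f (mat_unit i j)))"
proof -
  have 0: "f 0 = 0" using add[of 0 0] by simp
  have sum: "f (sum g S) = (\<Sum>x\<in>S. f (g x))" for g :: "'n \<Rightarrow> _" and S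
    by (induction S rule: infinite_finite_induct) (simp_all add: 0 add)
  show ?thesis
    using arg_cong[OF mat_unit_decomposition[of X], of f] unfolding sum scale .
qed

lemma gl_tensor_of_mat_unit: "gl_tensor_of (mat_unit i j) = Poly_Mapping.single [(i, j)] 1"
proof (rule poly_mapping_eqI)
  fix w :: "('a \<times> 'a) list"
  have "Poly_Mapping.lookup (gl_tensor_of (mat_unit i j)) w =
      (\<Sum>k\<in>UNIV. \<Sum>l\<in>UNIV. if k = i then if l = j then if w = [(i, j)] then 1 else 0 else 0 else 0)"
    unfolding gl_tensor_of_def lookup_sum
    by (intro sum.cong) (auto simp: lookup_single when_def mat_unit_def)
  also have "\<dots> = (\<Sum>k\<in>UNIV. if k = i then if w = [(i, j)] then 1 else 0 else 0)"
    by (intro sum.cong) auto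
  also have "\<dots> = Poly_Mapping.lookup (Poly_Mapping.single [(i, j)] 1) w"
    by (auto simp: lookup_single when_def)
  finally show "Poly_Mapping.lookup (gl_tensor_of (mat_unit i j)) w
      = Poly_Mapping.lookup (Poly_Mapping.single [(i, j)] 1) w" .
qed

lemma abs_rep_U_gl: "abs_U_gl (rep_U_gl a) = a"
  by (rule Quotient3_abs_rep[OF Quotient3_U_gl])

lemma rep_abs_U_gl: "rep_U_gl (abs_U_gl p) - p \<in> enveloping_ideal"
  by (rule rep_abs_rsp_left[OF Quotient3_U_gl]) (simp add: enveloping_ideal_0)

lemma U_gl_induct [case_names const add gen]:
  fixes a :: "'n::finite U_gl"
  assumes const: "\<And>c. P (U_const c)" and add: "\<And>a b. P a \<Longrightarrow> P b \<Longrightarrow> P (a + b)"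
    and gen: "\<And>X a. P a \<Longrightarrow> P (U_of X * a)"
  shows "P a"
proof -
  have word: "P (abs_U_gl (Poly_Mapping.single w c))" for w c
  proof (induction w)
    case Nil
    then show ?case using const[of c] by (simp add: U_const.abs_eq zero_list_def)
  next
    case (Cons x w)
    obtain i j where x: "x = (i, j)" by (cases x)
    have "abs_U_gl (Poly_Mapping.single (x # w) c)
        = U_of (mat_unit i j) * abs_U_gl (Poly_Mapping.single w c)"
      by (simp add: U_of.abs_eq times_U_gl.abs_eq gl_tensor_of_mat_unit x mult_single plus_list_def)
    then show ?case using gen[OF Cons] by simp
  qed
  have "P (abs_U_gl p)" for p
  proof (induction p rule: poly_mapping_additive_induct)
    case zero
    then show ?case using const[of 0] by (simp add: zero_U_gl.abs_eq)
  next
    case (add p q)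
    then show ?case using assms(2)[of "abs_U_gl p" "abs_U_gl q"] by (simp add: plus_U_gl.abs_eq)
  qed (rule word)
  from this[of "rep_U_gl a"] show ?thesis by (simp add: abs_rep_U_gl)
qed

lemma U_extension_ex1:
  fixes f :: "complex^'n^'n \<Rightarrow> 'n::finite U_mat"
  assumes add: "\<And>X Y. f (X + Y) = f X + f Y"
    and scale: "\<And>c X. f (map_matrix ((*) c) X) = map_matrix (U_scale c) (f X)"
    and bracket: "\<And>X Y. f (gl_bracket X Y) = gl_bracket (f X) (f Y)"
  shows "\<exists>!h. U_alg_hom h \<and> (\<forall>X. h (U_of X) = f X)"
proof
  have gen: "tensor_eval f (gl_tensor_of X) = f X" for X
    by (subst gl_linear_sum_units[OF add scale])
       (simp add: gl_tensor_of_def tensor_eval_sum tensor_eval_single word_eval_def)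
  have ideal: "tensor_eval f p = 0" if "p \<in> enveloping_ideal" for p
    using that
  proof induction
    case (generator a X Y b)
    then show ?case
      by (simp add: tensor_eval_mult tensor_eval_diff gen bracket gl_bracket_def[of "f X" "f Y"])
  qed (simp add: tensor_eval_add)
  have respects: "tensor_eval f p = tensor_eval f q" if "p - q \<in> enveloping_ideal" for p q
    using ideal[OF that] by (simp add: tensor_eval_diff)
  define h where "h a = tensor_eval f (rep_U_gl a)" for a
  have h_abs: "h (abs_U_gl p) = tensor_eval f p" for p
    unfolding h_def by (rule respects) (rule rep_abs_U_gl)
  have abs: "\<exists>p. a = abs_U_gl p" for a :: "'n U_gl"
    by (metis abs_rep_U_gl)
  have h1: "h 1 = mat 1"
  proof -
    have "tensor_eval f (Poly_Mapping.single 0 1) = mat 1"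
      by (subst tensor_eval_single) (simp add: word_eval_def zero_list_def)
    then show ?thesis by (simp add: one_U_gl.abs_eq h_abs)
  qed
  have hadd: "h (a + b) = h a + h b" for a b
    using abs[of a] abs[of b] by (auto simp: plus_U_gl.abs_eq h_abs tensor_eval_add)
  have hmult: "h (a * b) = h a ** h b" for a b
    using abs[of a] abs[of b] by (auto simp: times_U_gl.abs_eq h_abs tensor_eval_mult)
  have hconst: "h (U_const c) = map_matrix (U_scale c) (mat 1)" for c
    by (simp add: U_const.abs_eq h_abs tensor_eval_single word_eval_def zero_list_def)
  have hscale: "h (U_scale c a) = map_matrix (U_scale c) (h a)" for c a
    by (subst U_scale_def) (simp add: hmult hconst map_matrix_U_scale_mult)
  have "U_alg_hom h"
    by (simp add: U_alg_hom_def h1 hadd hmult hscale)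
  moreover have "h (U_of X) = f X" for X
    by (simp add: U_of.abs_eq h_abs gen)
  ultimately show "U_alg_hom h \<and> (\<forall>X. h (U_of X) = f X)" by blast
  show "k = h" if k: "U_alg_hom k \<and> (\<forall>X. k (U_of X) = f X)" for k
  proof
    fix a
    have kc: "k (U_const c) = map_matrix (U_scale c) (mat 1)" for c
    proof -
      have "k (U_scale c 1) = map_matrix (U_scale c) (k 1)" and "k 1 = mat 1"
        using k unfolding U_alg_hom_def by blast+
      then show ?thesis by (simp add: U_scale_def)
    qed
    show "k a = h a"
    proof (induction a rule: U_gl_induct)
      case (const c)
      then show ?case by (simp only: kc hconst)
    next
      case (add a b)
      then show ?case using k hadd by (simp add: U_alg_hom_def)
    next
      case (gen X a)
      then show ?case
        using k hmult \<open>\<And>X. h (U_of X) = f X\<close> by (simp add: U_alg_hom_def)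
    qed
  qed
qed

lemma U_extension:
  fixes f :: "complex^'n^'n \<Rightarrow> 'n::finite U_mat"
  assumes "\<And>X Y. f (X + Y) = f X + f Y"
    and "\<And>c X. f (map_matrix ((*) c) X) = map_matrix (U_scale c) (f X)"
    and "\<And>X Y. f (gl_bracket X Y) = gl_bracket (f X) (f Y)"
  shows "U_alg_hom (U_extension f)" and "U_extension f (U_of X) = f X"
  using theI'[OF U_extension_ex1[of f, OF assms]] unfolding U_extension_def by blast+

lemma U_tensor_mult: "U_tensor a X ** U_tensor b Y = U_tensor (a * b) (X ** Y)"
  by (simp add: vec_eq_iff U_tensor_def matrix_matrix_mult_def U_scale_mult_left
      U_scale_mult_right U_scale_sum_left mult.commute)

lemma U_tensor_trace: "trace (U_tensor a X) = U_scale (trace X) a"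
  by (simp add: trace_def U_tensor_def U_scale_sum_left)

lemma U_tensor_simps:
  "U_tensor a (X + Y) = U_tensor a X + U_tensor a Y"
  "U_tensor a (X - Y) = U_tensor a X - U_tensor a Y"
  "U_tensor (a + b) X = U_tensor a X + U_tensor b X"
  "U_tensor (a - b) X = U_tensor a X - U_tensor b X"
  "U_tensor a (map_matrix ((*) c) X) = map_matrix (U_scale c) (U_tensor a X)"
  "U_tensor (U_scale c a) X = map_matrix (U_scale c) (U_tensor a X)"
  by (simp_all add: vec_eq_iff U_tensor_def mult.commute)

lemma gl_bracket_U_tensor_add:
  "gl_bracket (U_tensor a (mat 1) + U_tensor 1 X) (U_tensor b (mat 1) + U_tensor 1 Y) =
     U_tensor (a * b - b * a) (mat 1) + U_tensor 1 (gl_bracket X Y)"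
  by (simp add: gl_bracket_def matrix_matrix_mult_add_right matrix_add_ldistrib U_tensor_mult
      U_tensor_simps)

lemma phi:
  fixes X :: "complex^'n::finite^'n"
  shows "U_alg_hom (phi :: 'n U_gl \<Rightarrow> 'n U_mat)"
    and "phi (U_of X) = U_tensor (U_of X) (mat 1) + U_tensor 1 X"
proof -
  let ?f = "\<lambda>X :: complex^'n^'n. U_tensor (U_of X) (mat 1) + U_tensor 1 X"
  have "?f (X + Y) = ?f X + ?f Y"
    and "?f (map_matrix ((*) c) X) = map_matrix (U_scale c) (?f X)"
    and "?f (gl_bracket X Y) = gl_bracket (?f X) (?f Y)" for X Y :: "complex^'n^'n" and c
    by (simp_all add: U_tensor_simps U_of_add U_of_scale U_of_bracket gl_bracket_U_tensor_add)
  note * = U_extension[of ?f, OF this]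
  show "U_alg_hom (phi :: 'n U_gl \<Rightarrow> 'n U_mat)" "phi (U_of X) = ?f X"
    unfolding phi_def using * by blast+
qed

lemma psi:
  fixes X :: "complex^'n::finite^'n"
  shows "U_alg_hom (psi :: 'n U_gl \<Rightarrow> 'n U_mat)"
    and "psi (U_of X) = U_tensor (U_of X) (mat 1) - U_tensor 1 (transpose X)"
proof -
  let ?f = "\<lambda>X :: complex^'n^'n. U_tensor (U_of X) (mat 1) - U_tensor 1 (transpose X)"
  have f: "?f X = U_tensor (U_of X) (mat 1) + U_tensor 1 (- transpose X)"
    for X :: "complex^'n^'n"
    by (simp add: vec_eq_iff U_tensor_def)
  have "- transpose (gl_bracket X Y) = gl_bracket (- transpose X) (- transpose Y)"
    for X Y :: "complex^'n^'n"
    by (simp add: vec_eq_iff gl_bracket_def transpose_def matrix_matrix_mult_def mult.commute)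
  then have "?f (gl_bracket X Y) = gl_bracket (?f X) (?f Y)" for X Y :: "complex^'n^'n"
    unfolding f by (simp add: U_of_bracket gl_bracket_U_tensor_add)
  moreover have "?f (X + Y) = ?f X + ?f Y"
    and "?f (map_matrix ((*) c) X) = map_matrix (U_scale c) (?f X)"
    for X Y :: "complex^'n^'n" and c
    by (simp_all add: U_of_add U_of_scale vec_eq_iff U_tensor_def transpose_def mult.commute)
  ultimately have "U_alg_hom (U_extension ?f)" "U_extension ?f (U_of X) = ?f X"
    using U_extension[of ?f] by blast+
  then show "U_alg_hom (psi :: 'n U_gl \<Rightarrow> 'n U_mat)" "psi (U_of X) = ?f X"
    unfolding psi_def by blast+
qed

end

theory Submission
  imports Defs
begin

text \<open>The diagonal blocks act by left multiplication by \<open>A\<close> and right multiplication by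
  \<open>- D\<close>, so they represent two commuting copies of \<open>gl\<^sub>n\<close>. The work lies in the
  off-diagonal blocks. Write \<open>b\<^sub>B\<close> (\<open>upper_act\<close>) and \<open>c\<^sub>C\<close> (\<open>lower_act\<close>) for the
  operators given by the blocks \<open>B\<close> and \<open>C\<close>.

  Because \<open>phi\<close> and \<open>psi\<close> are homomorphisms and the trace is invariant under cyclic
  shifts of scalar matrices, both operators commute with left multiplication by \<open>X\<close> in
  \<open>gl\<^sub>n\<close> up to a change of index:
  \<open>b\<^sub>B (X a) = X b\<^sub>B a - b\<^bsub>X B\<^esub> a\<close> and \<open>c\<^sub>C (X a) = X c\<^sub>C a + c\<^bsub>C X\<^esub> a\<close>
  (\<open>upper_act_mult_left\<close>, \<open>lower_act_mult_left\<close>). These two rules already are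
  the brackets of an off-diagonal block with \<open>A\<close>. They also have a further consequence: if one
  of the other bracket relations holds on an element \<open>a\<close> for all values of the blocks, then it
  holds on \<open>X a\<close> for all values of the blocks. Since \<open>U(gl\<^sub>n)\<close> is spanned by the
  elements obtained from \<open>1\<close> by such left multiplications (\<open>U_gl_induct_one\<close>), each
  remaining relation only has to be checked on \<open>1\<close>.

  On \<open>1\<close> the upper operator gives the scalar \<open>tr B\<close>, and the lower operator at the matrix
  unit \<open>(i,j)\<close> gives \<open>- g\<^sub>i\<^sub>j\<close> with
  \<open>g\<^sub>i\<^sub>j = \<Sum>\<^sub>r e\<^sub>i\<^sub>r e\<^sub>r\<^sub>j + \<delta>\<^sub>i\<^sub>j \<Sum>\<^sub>r e\<^sub>r\<^sub>r\<close>.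
  The elements \<open>g\<^sub>i\<^sub>j\<close> transform under the adjoint action as the \<open>e\<^sub>i\<^sub>j\<close> do
  (\<open>e_g_commute\<close>); this is the bracket of \<open>C\<close> with \<open>D\<close>. The substantial case is
  that two lower operators commute. Evaluated on \<open>1\<close> it says that
  \<open>c\<^sub>k\<^sub>l g\<^sub>i\<^sub>j\<close> is symmetric under exchange of \<open>(i,j)\<close> and \<open>(k,l)\<close>
  (\<open>lower_act_g_commute\<close>). The noncommutativity of the \<open>g\<^sub>i\<^sub>j\<close> is compensated
  there exactly by the correction terms coming from the index changes, and the summand with
  \<open>tr F\<close> in the action supplies those of lowest order. Similarly, evaluating \<open>b\<close> on
  \<open>g\<^sub>i\<^sub>j\<close> yields the bracket of \<open>B\<close> with \<open>C\<close>
  (\<open>upper_lower_act_commutator\<close>).\<close>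

section \<open>Linear maps on matrices\<close>

lemma map_matrix_scale_mult:
  fixes X Y :: "complex^'n::finite^'n"
  shows "map_matrix ((*) c) X ** Y = map_matrix ((*) c) (X ** Y)"
    and "X ** map_matrix ((*) c) Y = map_matrix ((*) c) (X ** Y)"
  by (simp_all add: vec_eq_iff matrix_matrix_mult_def sum_distrib_left algebra_simps)

lemma mat_unit_mult:
  "mat_unit i j ** mat_unit k l = (if j = k then mat_unit i l else (0 :: complex^'n::finite^'n))"
proof -
  have "(\<Sum>r\<in>UNIV. mat_unit i j $ p $ r * mat_unit k l $ r $ q)
      = (if j = k then mat_unit i l else 0) $ p $ q" for p q
  proof -
    have "(\<Sum>r\<in>UNIV. mat_unit i j $ p $ r * mat_unit k l $ r $ q)
        = (\<Sum>r\<in>UNIV. if r = j then (if p = i \<and> j = k \<and> q = l then 1 else 0) else 0)"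
      by (rule sum.cong) (auto simp: mat_unit_def)
    then show ?thesis by (auto simp: mat_unit_def)
  qed
  then show ?thesis by (simp add: vec_eq_iff matrix_matrix_mult_def)
qed

lemma trace_mat_unit: "trace (mat_unit i j) = (if i = j then 1 else 0)"
proof -
  have "trace (mat_unit i j) = (\<Sum>r\<in>UNIV. if r = i then (if i = j then 1 else 0) else 0)"
    unfolding trace_def by (rule sum.cong) (auto simp: mat_unit_def)
  then show ?thesis by simp
qed

text \<open>Identities that are linear in a matrix are reduced to matrix units by applying this to the
  difference of the two sides.\<close>

lemma matrix_linear_zeroI:
  fixes f :: "complex^'n^'n \<Rightarrow> 'n::finite U_gl"
  assumes add: "\<And>X Y. f (X + Y) = f X + f Y"
    and scale: "\<And>c X. f (map_matrix ((*) c) X) = U_scale c (f X)"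
    and unit: "\<And>i j. f (mat_unit i j) = 0"
  shows "f X = 0"
proof -
  have 0: "f 0 = 0" using add[of 0 0] by simp
  have sum: "f (sum g S) = (\<Sum>x\<in>S. f (g x))" for g :: "'n \<Rightarrow> _" and S
    by (induction S rule: infinite_finite_induct) (simp_all add: 0 add)
  show ?thesis
    by (subst mat_unit_decomposition) (simp add: sum scale unit)
qed

lemma U_of_0: "U_of 0 = 0"
  using U_of_add[of 0 0] by simp

lemma U_of_diff: "U_of (X - Y) = U_of X - U_of Y"
  using U_of_add[of "X - Y" Y] by (simp add: algebra_simps)

text \<open>The words in \<open>gl\<^sub>n\<close> span the enveloping algebra, and a word is built from \<open>1\<close> by
  left multiplications. This is the induction by which relations between operators spread from
  \<open>1\<close> to the whole algebra.\<close>

lemma U_gl_induct_one [case_names one add scale gen]: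
  fixes a :: "'n::finite U_gl"
  assumes one: "P 1" and add: "\<And>a b. P a \<Longrightarrow> P b \<Longrightarrow> P (a + b)"
    and scale: "\<And>c a. P a \<Longrightarrow> P (U_scale c a)"
    and gen: "\<And>X a. P a \<Longrightarrow> P (U_of X * a)"
  shows "P a"
proof (induction a rule: U_gl_induct)
  case (const c)
  show ?case using scale[OF one, of c] by (simp add: U_scale_def)
qed (auto intro: add gen)

text \<open>The trace of a product is not cyclic over a noncommutative ring, but the entries of a scalar
  matrix are central.\<close>

lemma trace_scalar_matrix_commute:
  fixes M :: "'n::finite U_mat"
  shows "trace (U_tensor 1 X ** M) = trace (M ** U_tensor 1 X)"
proof -
  have "trace (U_tensor 1 X ** M) = (\<Sum>i\<in>UNIV. \<Sum>j\<in>UNIV. U_scale (X $ i $ j) (M $ j $ i))"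
    by (simp add: trace_def matrix_matrix_mult_def U_tensor_def U_scale_mult_left)
  also have "\<dots> = (\<Sum>j\<in>UNIV. \<Sum>i\<in>UNIV. U_scale (X $ i $ j) (M $ j $ i))"
    by (rule sum.swap)
  finally show ?thesis
    by (simp add: trace_def matrix_matrix_mult_def U_tensor_def U_scale_mult_right)
qed

lemma trace_left_multiple:
  fixes M :: "'n::finite U_mat"
  shows "trace (U_tensor u (mat 1) ** M) = u * trace M"
proof -
  have "(\<Sum>j\<in>UNIV. U_scale (mat 1 $ i $ j) u * M $ j $ i) = u * M $ i $ i" for i
  proof -
    have "(\<Sum>j\<in>UNIV. U_scale (mat 1 $ i $ j) u * M $ j $ i)
        = (\<Sum>j\<in>UNIV. if j = i then u * M $ i $ i else 0)"
      by (rule sum.cong) (auto simp: mat_def)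
    then show ?thesis by simp
  qed
  then show ?thesis
    by (simp add: trace_def matrix_matrix_mult_def U_tensor_def sum_distrib_left)
qed

lemma trace_U_mat_add:
  fixes M N :: "'n::finite U_mat"
  shows "trace (M + N) = trace M + trace N" "trace (M - N) = trace M - trace N"
  by (simp_all add: trace_def sum.distrib sum_subtractf)

lemma U_scale_minus: "U_scale c (- a) = - U_scale c a"
  by (simp add: U_scale_def)

lemma trace_U_scale: "trace (map_matrix (U_scale c) M) = U_scale c (trace M)"
  by (simp add: trace_def U_scale_sum)

lemma U_alg_homD:
  assumes "U_alg_hom h"
  shows "h 1 = mat 1" "h (a + b) = h a + h b" "h (a * b) = h a ** h b"
    "h (U_scale c a) = map_matrix (U_scale c) (h a)"
  using assms by (simp_all add: U_alg_hom_def)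

lemmas phi_simps = U_alg_homD[OF phi(1)] phi(2)
lemmas psi_simps = U_alg_homD[OF psi(1)] psi(2)

section \<open>The action of the off-diagonal blocks\<close>

definition upper_act :: "complex^'n^'n \<Rightarrow> 'n::finite U_gl \<Rightarrow> 'n U_gl" where
  "upper_act B a = trace (psi a ** U_tensor 1 (transpose B))"

definition lower_act :: "complex^'n^'n \<Rightarrow> 'n::finite U_gl \<Rightarrow> 'n U_gl" where
  "lower_act C a =
     - trace (phi a ** F2 ** U_tensor 1 C) - trace (phi a ** U_tensor 1 C) * trace F1"

lemma matrix_diff_distrib:
  fixes A B :: "'a::ring_1^'n^'m"
  shows "(A - B) ** C = A ** C - B ** C" "D ** (A - B) = D ** A - D ** B"
  by (simp_all add: vec_eq_iff matrix_matrix_mult_def left_diff_distrib right_diff_distrib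
      sum_subtractf)

lemma transpose_linear:
  fixes X Y :: "complex^'n::finite^'n"
  shows "transpose (X + Y) = transpose X + transpose Y"
    and "transpose (map_matrix ((*) c) X) = map_matrix ((*) c) (transpose X)"
  by (simp_all add: vec_eq_iff transpose_def)

lemma upper_act_linear:
  "upper_act (B + B') a = upper_act B a + upper_act B' a"
  "upper_act (map_matrix ((*) c) B) a = U_scale c (upper_act B a)"
  "upper_act B (a + a') = upper_act B a + upper_act B a'"
  "upper_act B (U_scale c a) = U_scale c (upper_act B a)"
  by (simp_all add: upper_act_def transpose_linear U_tensor_simps matrix_add_ldistrib trace_U_mat_add
      map_matrix_U_scale_mult trace_U_scale psi_simps matrix_matrix_mult_add_right)

lemma lower_act_linear:
  "lower_act (C + C') a = lower_act C a + lower_act C' a"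
  "lower_act (map_matrix ((*) c) C) a = U_scale c (lower_act C a)"
  "lower_act C (a + a') = lower_act C a + lower_act C a'"
  "lower_act C (U_scale c a) = U_scale c (lower_act C a)"
  by (simp_all add: lower_act_def U_tensor_simps matrix_add_ldistrib trace_U_mat_add distrib_right
      map_matrix_U_scale_mult trace_U_scale phi_simps matrix_matrix_mult_add_right
      U_scale_mult_left U_scale_minus)

text \<open>The index changes on the side of \<open>X\<close> because \<open>psi (U_of X)\<close> carries the scalar matrix
  \<open>transpose X\<close> on the far left, and cyclicity moves it next to \<open>transpose B\<close>.\<close>

lemma upper_act_mult_left:
  "upper_act B (U_of X * a) = U_of X * upper_act B a - upper_act (X ** B) a"
proof -
  let ?B = "U_tensor 1 (transpose B) :: 'a U_mat"
  have "trace (U_tensor 1 (transpose X) ** psi a ** ?B)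
      = trace (psi a ** (?B ** U_tensor 1 (transpose X)))"
    by (metis trace_scalar_matrix_commute matrix_mul_assoc)
  also have "?B ** U_tensor 1 (transpose X) = U_tensor 1 (transpose (X ** B))"
    by (simp add: U_tensor_mult matrix_transpose_mul)
  finally show ?thesis
    by (simp add: upper_act_def psi_simps matrix_diff_distrib trace_U_mat_add trace_left_multiple
        flip: matrix_mul_assoc)
qed

text \<open>The scalar matrix \<open>X\<close> in \<open>phi (U_of X)\<close> moves cyclically past \<open>C\<close>. The factor
  between \<open>phi a\<close> and \<open>C\<close> stays in place, so the same computation, with that factor
  \<open>F2\<close> or the unit matrix, serves both summands.\<close>

lemma lower_act_mult_left:
  "lower_act C (U_of X * a) = U_of X * lower_act C a + lower_act (C ** X) a"
proof -
  have cyc: "trace (U_tensor 1 X ** M ** U_tensor 1 C) = trace (M ** U_tensor 1 (C ** X))"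
    for M :: "'a U_mat"
    by (metis trace_scalar_matrix_commute matrix_mul_assoc U_tensor_mult mult_1)
  have "trace (phi (U_of X * a) ** M ** U_tensor 1 C)
      = U_of X * trace (phi a ** M ** U_tensor 1 C) + trace (phi a ** M ** U_tensor 1 (C ** X))"
    for M :: "'a U_mat"
    using cyc[of "phi a ** M"]
    by (simp add: phi_simps matrix_matrix_mult_add_right trace_U_mat_add trace_left_multiple
        flip: matrix_mul_assoc)
  from this[of F2] this[of "mat 1"] show ?thesis
    by (simp add: lower_act_def algebra_simps)
qed

lemma upper_act_one: "upper_act B 1 = U_const (trace B)"
  proof -
  have "trace (transpose B) = trace B" by (simp add: trace_def transpose_def)
  then show ?thesis by (simp add: upper_act_def psi_simps U_tensor_trace U_scale_def)
qed

abbreviation e :: "'n \<Rightarrow> 'n \<Rightarrow> 'n::finite U_gl" where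
  "e i j \<equiv> U_of (mat_unit i j)"

text \<open>The lower operators create these elements from \<open>1\<close>, up to sign. The first summand is
  the \<open>(i,j)\<close> entry of the square of the matrix with entries \<open>e\<^sub>i\<^sub>j\<close>.\<close>

definition g :: "'n \<Rightarrow> 'n \<Rightarrow> 'n::finite U_gl" where
  "g i j = (\<Sum>r\<in>UNIV. e i r * e r j) + (if i = j then \<Sum>r\<in>UNIV. e r r else 0)"

lemma trace_mult_mat_unit:
  fixes M :: "'n::finite U_mat"
  shows "trace (M ** U_tensor 1 (mat_unit i j)) = M $ j $ i"
proof -
  have "(\<Sum>q\<in>UNIV. M $ p $ q * U_scale (mat_unit i j $ q $ p) 1)
      = (if p = j then M $ j $ i else 0)" for p
  proof -
    have "(\<Sum>q\<in>UNIV. M $ p $ q * U_scale (mat_unit i j $ q $ p) 1)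
        = (\<Sum>q\<in>UNIV. if q = i then (if p = j then M $ j $ i else 0) else 0)"
      by (rule sum.cong) (auto simp: mat_unit_def)
    then show ?thesis by simp
  qed
  then show ?thesis
    by (simp add: trace_def matrix_matrix_mult_def U_tensor_def)
qed

text \<open>\<open>F1\<close> and \<open>F2\<close> are transposed: the coefficient with indices \<open>i, j\<close> stands at the
  matrix unit \<open>(j, i)\<close>.\<close>

lemma sum_units_entry:
  fixes h :: "'n::finite \<Rightarrow> 'n \<Rightarrow> 'n U_gl"
  shows "(\<Sum>i\<in>UNIV. \<Sum>j\<in>UNIV. U_tensor (h i j) (mat_unit j i)) $ l $ k = h k l"
proof -
  have "(\<Sum>j\<in>UNIV. U_tensor (h i j) (mat_unit j i) $ l $ k) = (if i = k then h k l else 0)" for i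
  proof -
    have "(\<Sum>j\<in>UNIV. U_tensor (h i j) (mat_unit j i) $ l $ k)
       = (\<Sum>j\<in>UNIV. if j = l then (if i = k then h k l else 0) else 0)"
      by (rule sum.cong) (auto simp: U_tensor_def mat_unit_def)
    then show ?thesis by simp
  qed
  then show ?thesis by simp
qed

lemma F2_entry:
  fixes k l :: "'n::finite"
  shows "F2 $ l $ k = (\<Sum>r\<in>UNIV. e k r * e r l)"
proof -
  have "U_tensor (sum f S) X = (\<Sum>r\<in>S. U_tensor (f r) X)" for f :: "'n \<Rightarrow> 'n U_gl" and S X
    by (simp add: U_tensor_def vec_eq_iff U_scale_sum)
  then have F2: "(F2 :: 'n U_mat) = (\<Sum>i\<in>UNIV. \<Sum>j\<in>UNIV. U_tensor (\<Sum>r\<in>UNIV. e i r * e r j) (mat_unit j i))"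
    by (simp add: F2_def)
  show ?thesis
    unfolding F2 by (rule sum_units_entry)
qed

lemma trace_F1: "trace (F1 :: 'n::finite U_mat) = (\<Sum>r\<in>UNIV. e r r)"
proof -
  have F1: "(F1 :: 'n U_mat) = (\<Sum>j\<in>UNIV. \<Sum>i\<in>UNIV. U_tensor (e j i) (mat_unit i j))"
    unfolding F1_def by (rule sum.swap)
  have "F1 $ r $ r = e r r" for r :: 'n
    unfolding F1 by (rule sum_units_entry)
  then show ?thesis by (simp add: trace_def)
qed

lemma lower_act_one: "lower_act (mat_unit k l) 1 = - g k l"
  by (simp add: lower_act_def phi_simps trace_mult_mat_unit F2_entry U_tensor_trace trace_mat_unit
      g_def trace_F1)

section \<open>Commutators in the enveloping algebra\<close>

lemma e_e_commute:
  "e i j * e k l = e k l * e i j + (if j = k then e i l else 0) - (if l = i then e k j else 0)"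
proof -
  have "U_of (gl_bracket (mat_unit i j) (mat_unit k l))
      = (if j = k then e i l else 0) - (if l = i then e k j else 0)"
    by (simp add: gl_bracket_def mat_unit_mult U_of_diff U_of_0)
  then show ?thesis by (simp add: U_of_bracket algebra_simps)
qed

text \<open>Summed over \<open>r\<close>, the two inner contributions of \<open>e\<^sub>k\<^sub>r e\<^sub>r\<^sub>l\<close> to the commutator
  cancel, and the sum of the \<open>e\<^sub>r\<^sub>r\<close> is central.\<close>

lemma e_g_commute:
  "e i j * g k l = g k l * e i j + (if j = k then g i l else 0) - (if l = i then g k j else 0)"
proof -
  have "e i j * e k r * e r l = e k r * e r l * e i j
      + (if j = k then e i r * e r l else 0) - (if r = i then e k j * e i l else 0)
      + (if r = j then e k j * e i l else 0) - (if l = i then e k r * e r j else 0)" for r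
  proof -
    have "e i j * e k r * e r l = e k r * (e i j * e r l)
       + (if j = k then e i r * e r l else 0) - (if r = i then e k j * e i l else 0)"
      by (simp add: e_e_commute[of i j k r] algebra_simps)
    also have "e i j * e r l = e r l * e i j + (if r = j then e i l else 0) - (if l = i then e r j else 0)"
      by (simp add: e_e_commute[of i j r l])
    finally show ?thesis by (auto simp add: algebra_simps)
  qed
  then have quad: "e i j * (\<Sum>r\<in>UNIV. e k r * e r l) = (\<Sum>r\<in>UNIV. e k r * e r l) * e i j
      + (if j = k then \<Sum>r\<in>UNIV. e i r * e r l else 0)
      - (if l = i then \<Sum>r\<in>UNIV. e k r * e r j else 0)"
    by (simp add: sum_distrib_left sum_distrib_right sum.distrib sum_subtractf mult.assoc)
  have "e i j * e r r = e r r * e i j + (if r = j then e i j else 0) - (if r = i then e i j else 0)" for r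
    by (simp add: e_e_commute[of i j r r])
  then have tr: "e i j * (\<Sum>r\<in>UNIV. e r r) = (\<Sum>r\<in>UNIV. e r r) * e i j"
    by (simp add: sum_distrib_left sum_distrib_right sum.distrib sum_subtractf)
  show ?thesis
    unfolding g_def distrib_left distrib_right quad
    using tr by (auto simp: algebra_simps)
qed

text \<open>Up to a central multiple of the identity, the matrix \<open>g\<close> is the square of the matrix
  \<open>e\<close>, so the two matrices commute by associativity, although their entries do not.\<close>

lemma e_g_matrix_commute: "(\<Sum>r\<in>UNIV. e i r * g r l) = (\<Sum>r\<in>UNIV. g i r * e r l)"
proof -
  define t where "t = (\<Sum>r\<in>(UNIV :: 'a set). e r r)"
  have g: "g i j = (\<Sum>s\<in>UNIV. e i s * e s j) + (if i = j then t else 0)" for i j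
    by (simp add: g_def t_def)
  have "e i l * e r r = e r r * e i l + (if r = l then e i l else 0) - (if r = i then e i l else 0)" for r
    by (simp add: e_e_commute[of i l r r])
  then have tr: "e i l * t = t * e i l"
    by (simp add: t_def sum_distrib_left sum_distrib_right sum.distrib sum_subtractf)
  have "(\<Sum>r\<in>UNIV. e i r * g r l) = (\<Sum>r\<in>UNIV. \<Sum>s\<in>UNIV. e i r * e r s * e s l) + e i l * t"
    by (simp add: g distrib_left sum.distrib sum_distrib_left mult.assoc if_distrib[of "(*) _"]
        cong: if_cong)
  also have "\<dots> = (\<Sum>s\<in>UNIV. \<Sum>r\<in>UNIV. e i r * e r s * e s l) + t * e i l"
    by (subst sum.swap) (simp only: tr)
  also have "\<dots> = (\<Sum>r\<in>UNIV. g i r * e r l)"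
    by (simp add: g distrib_right sum.distrib sum_distrib_right mult.assoc if_distrib[of "\<lambda>x. x * _"]
        cong: if_cong)
  finally show ?thesis .
qed

text \<open>This is the derivation property of the commutator applied to the factors of
  \<open>e\<^sub>i\<^sub>r e\<^sub>r\<^sub>j\<close>. The result is kept in terms of products of \<open>e\<close> and \<open>g\<close>, because these are
  the correction terms that occur in \<open>lower_act_g\<close>.\<close>

lemma g_g_commutator: "g i j * g k l - g k l * g i j
    = (if j = k then \<Sum>r\<in>UNIV. e i r * g r l else 0) - e i l * g k j + g i l * e k j
      - (if l = i then \<Sum>r\<in>UNIV. g k r * e r j else 0)"
proof -
  have "e i r * e r j * g k l = g k l * (e i r * e r j)
      + (if j = k then e i r * g r l else 0) - (if r = l then e i l * g k j else 0)
      + (if r = k then g i l * e k j else 0) - (if l = i then g k r * e r j else 0)" for r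
  proof -
    have "e i r * e r j * g k l = e i r * g k l * e r j
       + (if j = k then e i r * g r l else 0) - (if r = l then e i l * g k j else 0)"
      by (simp add: mult.assoc e_g_commute[of r j k l] algebra_simps)
    also have "e i r * g k l = g k l * e i r + (if r = k then g i l else 0) - (if l = i then g k r else 0)"
      by (simp add: e_g_commute[of i r k l])
    finally show ?thesis by (auto simp add: algebra_simps)
  qed
  then have quad: "(\<Sum>r\<in>UNIV. e i r * e r j) * g k l = g k l * (\<Sum>r\<in>UNIV. e i r * e r j)
      + (if j = k then \<Sum>r\<in>UNIV. e i r * g r l else 0) - e i l * g k j + g i l * e k j
      - (if l = i then \<Sum>r\<in>UNIV. g k r * e r j else 0)"
    by (simp add: sum_distrib_left sum_distrib_right sum.distrib sum_subtractf)
  have "e r r * g k l = g k l * e r r + (if r = k then g k l else 0) - (if r = l then g k l else 0)" for r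
    by (auto simp: e_g_commute[of r r k l])
  then have tr: "(\<Sum>r\<in>UNIV. e r r) * g k l = g k l * (\<Sum>r\<in>UNIV. e r r)"
    by (simp add: sum_distrib_left sum_distrib_right sum.distrib sum_subtractf)
  show ?thesis
    unfolding g_def[of i j] distrib_left distrib_right quad
    using tr by (auto simp: algebra_simps)
qed


section \<open>Commutation relations on the enveloping algebra\<close>

lemma act_matrix_0 [simp]: "upper_act 0 a = 0" "lower_act 0 a = 0"
  using upper_act_linear(1)[of 0 0 a] lower_act_linear(1)[of 0 0 a] by simp_all

lemma act_0 [simp]: "upper_act B 0 = 0" "lower_act C 0 = 0"
  using upper_act_linear(3)[of B 0 0] lower_act_linear(3)[of C 0 0] by simp_all

lemma act_uminus: "upper_act B (- a) = - upper_act B a" "lower_act C (- a) = - lower_act C a"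
  using upper_act_linear(3)[of B a "- a"] lower_act_linear(3)[of C a "- a"]
  by (simp_all add: eq_neg_iff_add_eq_0 add.commute)

lemma act_diff: "upper_act B (a - a') = upper_act B a - upper_act B a'"
  "lower_act C (a - a') = lower_act C a - lower_act C a'"
  using upper_act_linear(3)[of B a "- a'"] lower_act_linear(3)[of C a "- a'"]
  by (simp_all add: act_uminus)

lemma act_matrix_diff: "upper_act (B - B') a = upper_act B a - upper_act B' a"
  "lower_act (C - C') a = lower_act C a - lower_act C' a"
  using upper_act_linear(1)[of "B - B'" B' a] lower_act_linear(1)[of "C - C'" C' a]
  by (simp_all add: algebra_simps)

lemma act_sum: "upper_act B (sum f S) = (\<Sum>x\<in>S. upper_act B (f x))"
  "lower_act C (sum f S) = (\<Sum>x\<in>S. lower_act C (f x))"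
  by (induction S rule: infinite_finite_induct) (simp_all add: upper_act_linear lower_act_linear)

lemma act_if: "upper_act B (if P then a else 0) = (if P then upper_act B a else 0)"
  "lower_act C (if P then a else 0) = (if P then lower_act C a else 0)"
  "upper_act (if P then B else 0) a = (if P then upper_act B a else 0)"
  "lower_act (if P then C else 0) a = (if P then lower_act C a else 0)"
  by simp_all

text \<open>On \<open>1\<close> left and right multiplication by \<open>X\<close> agree, so the claim is the symmetry of
  \<open>tr (X B)\<close>; the left rule spreads it to all of the algebra. This is the bracket of \<open>B\<close>
  with \<open>D\<close>.\<close>

lemma upper_act_mult_right:
  "upper_act B (a * U_of X) = upper_act B a * U_of X - upper_act (B ** X) a"
proof (induction a arbitrary: B rule: U_gl_induct_one)
  case one
  have "upper_act B (U_of X) = U_of X * upper_act B 1 - upper_act (X ** B) 1"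
    using upper_act_mult_left[of B X 1] by simp
  then show ?case
    by (simp add: upper_act_one U_const_central trace_mul_sym[of X B])
next
  case (gen Y a)
  then show ?case
    by (simp add: mult.assoc upper_act_mult_left matrix_mul_assoc right_diff_distrib
        left_diff_distrib)
qed (simp_all add: upper_act_linear distrib_right U_scale_mult_left)

text \<open>On \<open>1\<close> this compares left and right multiplication of \<open>lower_act C 1\<close> by \<open>X\<close>, which
  is the adjoint equivariance of the elements \<open>g\<^sub>i\<^sub>j\<close>. It expresses the bracket of \<open>C\<close> with
  \<open>D\<close>.\<close>

lemma lower_act_mult_right:
  "lower_act C (a * U_of X) = lower_act C a * U_of X + lower_act (X ** C) a"
proof (induction a arbitrary: C rule: U_gl_induct_one)
  case one
  have "U_of X * lower_act C 1 + lower_act (C ** X) 1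
      - lower_act C 1 * U_of X - lower_act (X ** C) 1 = 0"
  proof (rule matrix_linear_zeroI[where X = X])
    fix i j
    show "U_of (mat_unit i j) * lower_act C 1 + lower_act (C ** mat_unit i j) 1
        - lower_act C 1 * U_of (mat_unit i j) - lower_act (mat_unit i j ** C) 1 = 0"
    proof (rule matrix_linear_zeroI[where X = C])
      fix k l
      show "U_of (mat_unit i j) * lower_act (mat_unit k l) 1
          + lower_act (mat_unit k l ** mat_unit i j) 1
          - lower_act (mat_unit k l) 1 * U_of (mat_unit i j)
          - lower_act (mat_unit i j ** mat_unit k l) 1 = 0"
        by (simp add: mat_unit_mult lower_act_one act_if e_g_commute[of i j k l])
    qed (simp_all add: lower_act_linear matrix_add_ldistrib matrix_matrix_mult_add_right
        map_matrix_scale_mult U_scale_mult_left U_scale_mult_right algebra_simps)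
  qed (simp_all add: lower_act_linear U_of_add U_of_scale matrix_add_ldistrib
      matrix_matrix_mult_add_right map_matrix_scale_mult U_scale_mult_left U_scale_mult_right
      algebra_simps)
  then show ?case
    using lower_act_mult_left[of C X 1] by (simp add: algebra_simps)
next
  case (gen Y a)
  then show ?case
    by (simp add: mult.assoc lower_act_mult_left matrix_mul_assoc algebra_simps)
qed (simp_all add: lower_act_linear algebra_simps U_scale_mult_left)

lemma upper_act_commute: "upper_act B (upper_act B' a) = upper_act B' (upper_act B a)"
proof (induction a arbitrary: B B' rule: U_gl_induct_one)
  case one
  have "upper_act B (U_const c) = U_scale c (U_const (trace B))"
    for B :: "complex^'a^'a" and c
    using upper_act_linear(4)[of B c 1] by (simp add: upper_act_one U_scale_def)
  then show ?case
    by (simp add: upper_act_one U_scale_def mult.commute flip: U_const_mult)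
qed (simp_all add: upper_act_linear upper_act_mult_left act_diff algebra_simps)

text \<open>The left rule is applied to both factors of \<open>e\<^sub>i\<^sub>r e\<^sub>r\<^sub>j\<close>. Moving \<open>e\<^sub>r\<^sub>j\<close> to the right
  of \<open>g\<^sub>k\<^sub>r\<close> in the term with \<open>l = i\<close> cancels the contribution \<open>g\<^sub>k\<^sub>j\<close> that is
  independent of \<open>r\<close>, and with it a multiple of \<open>g\<^sub>k\<^sub>j\<close> by the size \<open>n\<close>.\<close>

lemma lower_act_g: "lower_act (mat_unit k l) (g i j) = - (g i j * g k l + e i l * g k j
    + (if l = i then (\<Sum>r\<in>UNIV. g k r * e r j) + (if k = j then \<Sum>r\<in>UNIV. g r r else 0) else 0)
    + (if i = j then g k l else 0))"
proof -
  have "lower_act (mat_unit k l) (e i r * e r j) = - (e i r * e r j * g k l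
      + (if r = l then e i l * g k j else 0)
      + (if l = i then g k r * e r j + (if k = j then g r r else 0) else 0))" for r
  proof -
    have e: "lower_act (mat_unit p q) (e r j) = - (e r j * g p q + (if q = r then g p j else 0))"
      for p q
      using lower_act_mult_left[of "mat_unit p q" "mat_unit r j" 1]
      by (simp add: lower_act_one mat_unit_mult act_if)
    show ?thesis
      by (auto simp add: lower_act_mult_left mat_unit_mult act_if e e_g_commute[of r j k r] algebra_simps)
  qed
  then have quad: "lower_act (mat_unit k l) (\<Sum>r\<in>UNIV. e i r * e r j)
      = - ((\<Sum>r\<in>UNIV. e i r * e r j) * g k l + e i l * g k j
      + (if l = i then (\<Sum>r\<in>UNIV. g k r * e r j)
          + (if k = j then \<Sum>r\<in>UNIV. g r r else 0) else 0))"
    by (simp add: act_sum sum_negf sum.distrib sum_distrib_right del: minus_add_distrib)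
  have "lower_act (mat_unit k l) (e r r) = - (e r r * g k l + (if r = l then g k l else 0))" for r
    using lower_act_mult_left[of "mat_unit k l" "mat_unit r r" 1]
    by (simp add: lower_act_one mat_unit_mult act_if)
  then have tr: "lower_act (mat_unit k l) (\<Sum>r\<in>UNIV. e r r) = - ((\<Sum>r\<in>UNIV. e r r) * g k l + g k l)"
    by (simp add: act_sum sum_negf sum.distrib sum_distrib_right del: minus_add_distrib)
  show ?thesis
    unfolding g_def[of i j] lower_act_linear quad distrib_right
    using tr by (auto simp: algebra_simps)
qed

text \<open>The commutator of \<open>g\<^sub>i\<^sub>j\<close> and \<open>g\<^sub>k\<^sub>l\<close> cancels the other terms of \<open>lower_act_g\<close> up to
  two remainders: an entry of \<open>e g - g e\<close>, which vanishes, and the commutator of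
  \<open>e\<^sub>k\<^sub>j\<close> with \<open>g\<^sub>i\<^sub>l\<close>, which is compensated by the terms with \<open>i = j\<close> and
  \<open>k = l\<close> that come from the trace summand in \<open>g\<close>.\<close>

lemma lower_act_g_commute: "lower_act (mat_unit k l) (g i j) = lower_act (mat_unit i j) (g k l)"
proof -
  have "lower_act (mat_unit i j) (g k l) - lower_act (mat_unit k l) (g i j) =
     (g i j * g k l - g k l * g i j) + e i l * g k j - e k j * g i l
    + (if l = i then \<Sum>r\<in>UNIV. g k r * e r j else 0)
    - (if j = k then \<Sum>r\<in>UNIV. g i r * e r l else 0)
    + (if i = j then g k l else 0) - (if k = l then g i j else 0)"
    by (auto simp: lower_act_g)
  also have "\<dots> = 0"
    by (auto simp: g_g_commutator e_g_matrix_commute e_g_commute[of k j i l])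
  finally show ?thesis by simp
qed

lemma lower_act_commute: "lower_act C (lower_act C' a) = lower_act C' (lower_act C a)"
proof (induction a arbitrary: C C' rule: U_gl_induct_one)
  case one
  have "lower_act C (lower_act C' 1) - lower_act C' (lower_act C 1) = 0"
  proof (rule matrix_linear_zeroI[where X = C])
    fix i j
    show "lower_act (mat_unit i j) (lower_act C' 1) - lower_act C' (lower_act (mat_unit i j) 1) = 0"
      by (rule matrix_linear_zeroI[where X = C'])
        (simp_all add: lower_act_linear lower_act_one act_uminus lower_act_g_commute)
  qed (simp_all add: lower_act_linear)
  then show ?case by simp
qed (simp_all add: lower_act_linear lower_act_mult_left algebra_simps)

lemma upper_act_g: "upper_act (mat_unit k l) (g i j) =
    (if k = l then g i j else 0) - (if j = k then e i l else 0) - (if l = i then e k j else 0)"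
proof -
  have e: "upper_act B (e r s) = e r s * U_const (trace B) - U_const (trace (mat_unit r s ** B))"
    for r s :: 'a and B
    using upper_act_mult_left[of B "mat_unit r s" 1] by (simp add: upper_act_one)
  have [simp]: "trace (0 :: complex^'a^'a) = 0"
    by (simp add: trace_def)
  have "upper_act (mat_unit k l) (e i r * e r j) = (if k = l then e i r * e r j else 0)
      - (if r = l then if j = k then e i l else 0 else 0)
      - (if r = k then if l = i then e k j else 0 else 0)
      + (if r = k then if i = j \<and> k = l then 1 else 0 else 0)" for r
    by (auto simp: upper_act_mult_left mat_unit_mult act_if e trace_mat_unit algebra_simps)
  then have quad: "upper_act (mat_unit k l) (\<Sum>r\<in>UNIV. e i r * e r j) =
      (if k = l then \<Sum>r\<in>UNIV. e i r * e r j else 0)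
      - (if j = k then e i l else 0) - (if l = i then e k j else 0)
      + (if i = j \<and> k = l then 1 else 0)"
    by (simp add: act_sum sum.distrib sum_subtractf)
  have "upper_act (mat_unit k l) (e r r) = (if k = l then e r r else 0)
      - (if r = k then if k = l then 1 else 0 else 0)" for r
    by (auto simp: e mat_unit_mult trace_mat_unit)
  then have tr: "upper_act (mat_unit k l) (\<Sum>r\<in>UNIV. e r r)
      = (if k = l then \<Sum>r\<in>UNIV. e r r else 0) - (if k = l then 1 else 0)"
    by (simp add: act_sum sum_subtractf)
  show ?thesis
    unfolding g_def[of i j] upper_act_linear quad
    using tr by (auto simp: algebra_simps)
qed

text \<open>In the inductive step the left rules produce the relation for \<open>(X B, C)\<close> and for
  \<open>(B, C X)\<close> with opposite signs. Their right multiplications cancel, and the remaining left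
  multiplications supply exactly the commutator of \<open>B C\<close> with \<open>X\<close>.\<close>

lemma upper_lower_act_commutator:
  "upper_act B (lower_act C a) - lower_act C (upper_act B a) = U_of (B ** C) * a + a * U_of (C ** B)"
proof (induction a arbitrary: B C rule: U_gl_induct_one)
  case one
  have "upper_act B (lower_act C 1) - lower_act C (upper_act B 1)
      - U_of (B ** C) - U_of (C ** B) = 0"
  proof (rule matrix_linear_zeroI[where X = B])
    fix k l
    show "upper_act (mat_unit k l) (lower_act C 1) - lower_act C (upper_act (mat_unit k l) 1)
        - U_of (mat_unit k l ** C) - U_of (C ** mat_unit k l) = 0"
      by (rule matrix_linear_zeroI[where X = C])
        (auto simp: lower_act_linear upper_act_linear U_of_add U_of_scale matrix_add_ldistrib
          matrix_matrix_mult_add_right map_matrix_scale_mult lower_act_one upper_act_one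
          act_uminus upper_act_g trace_mat_unit mat_unit_mult U_of_0)
  qed (simp_all add: lower_act_linear upper_act_linear U_of_add U_of_scale matrix_add_ldistrib
      matrix_matrix_mult_add_right map_matrix_scale_mult)
  then show ?case by (simp add: algebra_simps)
next
  case (add a b)
  then show ?case
    by (simp add: lower_act_linear upper_act_linear algebra_simps)
next
  case (scale c a)
  then show ?case
    by (simp add: lower_act_linear upper_act_linear U_scale_mult_left U_scale_mult_right
        flip: U_scale_diff)
next
  case (gen X a)
  have "upper_act B (lower_act C (U_of X * a)) - lower_act C (upper_act B (U_of X * a))
      = U_of X * (upper_act B (lower_act C a) - lower_act C (upper_act B a))
        - (upper_act (X ** B) (lower_act C a) - lower_act C (upper_act (X ** B) a))
        + (upper_act B (lower_act (C ** X) a) - lower_act (C ** X) (upper_act B a))"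
    by (simp add: lower_act_mult_left upper_act_mult_left lower_act_linear upper_act_linear act_diff
        algebra_simps)
  also have "\<dots> = U_of X * (U_of (B ** C) * a) - U_of (X ** (B ** C)) * a
       + U_of ((B ** C) ** X) * a + U_of X * a * U_of (C ** B)"
    unfolding gen by (simp add: algebra_simps matrix_mul_assoc)
  also have "\<dots> = U_of (B ** C) * (U_of X * a) + U_of X * a * U_of (C ** B)"
  proof -
    have "U_of (X ** (B ** C)) + U_of (gl_bracket (B ** C) X) = U_of ((B ** C) ** X)"
      by (simp add: gl_bracket_def flip: U_of_add)
    then have "U_of ((B ** C) ** X) = U_of (X ** (B ** C)) + U_of (B ** C) * U_of X
        - U_of X * U_of (B ** C)"
      by (simp add: U_of_bracket algebra_simps)
    from arg_cong[OF this, of "\<lambda>u. u * a"] show ?thesis by (simp add: algebra_simps)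
  qed
  finally show ?case .
qed

section \<open>The module structure\<close>

definition block_ul :: "'a^('n + 'n)^('n + 'n) \<Rightarrow> 'a^'n^'n" where
  "block_ul M = (\<chi> i j. M $ Inl i $ Inl j)"
definition block_ur :: "'a^('n + 'n)^('n + 'n) \<Rightarrow> 'a^'n^'n" where
  "block_ur M = (\<chi> i j. M $ Inl i $ Inr j)"
definition block_ll :: "'a^('n + 'n)^('n + 'n) \<Rightarrow> 'a^'n^'n" where
  "block_ll M = (\<chi> i j. M $ Inr i $ Inl j)"
definition block_lr :: "'a^('n + 'n)^('n + 'n) \<Rightarrow> 'a^'n^'n" where
  "block_lr M = (\<chi> i j. M $ Inr i $ Inr j)"

lemmas block_defs = block_ul_def block_ur_def block_ll_def block_lr_def

lemma block_linear:
  fixes M N :: "complex^('n::finite + 'n)^('n + 'n)"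
  shows "block_ul (M + N) = block_ul M + block_ul N" "block_ur (M + N) = block_ur M + block_ur N"
    "block_ll (M + N) = block_ll M + block_ll N" "block_lr (M + N) = block_lr M + block_lr N"
    "block_ul (map_matrix ((*) c) M) = map_matrix ((*) c) (block_ul M)"
    "block_ur (map_matrix ((*) c) M) = map_matrix ((*) c) (block_ur M)"
    "block_ll (map_matrix ((*) c) M) = map_matrix ((*) c) (block_ll M)"
    "block_lr (map_matrix ((*) c) M) = map_matrix ((*) c) (block_lr M)"
  by (simp_all add: block_defs vec_eq_iff)

lemma sum_UNIV_Plus:
  fixes f :: "'n::finite + 'n \<Rightarrow> 'a::comm_monoid_add"
  shows "(\<Sum>p\<in>UNIV. f p) = (\<Sum>i\<in>UNIV. f (Inl i)) + (\<Sum>i\<in>UNIV. f (Inr i))"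
  using sum.Plus[of UNIV UNIV f] by (simp add: UNIV_Plus_UNIV)

lemma block_bracket:
  fixes M N :: "complex^('n::finite + 'n)^('n + 'n)"
  shows "block_ul (gl_bracket M N) = gl_bracket (block_ul M) (block_ul N)
      + (block_ur M ** block_ll N - block_ur N ** block_ll M)"
    and "block_ur (gl_bracket M N) = block_ul M ** block_ur N + block_ur M ** block_lr N
      - block_ul N ** block_ur M - block_ur N ** block_lr M"
    and "block_ll (gl_bracket M N) = block_ll M ** block_ul N + block_lr M ** block_ll N
      - block_ll N ** block_ul M - block_lr N ** block_ll M"
    and "block_lr (gl_bracket M N) = block_ll M ** block_ur N - block_ll N ** block_ur M
      + gl_bracket (block_lr M) (block_lr N)"
  by (simp_all add: gl_bracket_def block_defs vec_eq_iff matrix_matrix_mult_def sum_UNIV_Plus)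

lemma gl2n_action_blocks:
  "gl2n_action M a = U_of (block_ul M) * a - a * U_of (block_lr M)
     + upper_act (block_ur M) a + lower_act (block_ll M) a"
  by (simp add: gl2n_action_def block_defs upper_act_def lower_act_def Let_def)

lemma gl2n_action_linear:
  "gl2n_action (M + N) a = gl2n_action M a + gl2n_action N a"
  "gl2n_action (map_matrix ((*) c) M) a = U_scale c (gl2n_action M a)"
  "gl2n_action M (a + b) = gl2n_action M a + gl2n_action M b"
  "gl2n_action M (U_scale c a) = U_scale c (gl2n_action M a)"
  by (simp_all add: gl2n_action_blocks block_linear U_of_add U_of_scale upper_act_linear
      lower_act_linear U_scale_mult_left U_scale_mult_right algebra_simps)

text \<open>Both sides are expanded block by block: the mixed terms of a diagonal and an off-diagonal block
  match by the left and right rules, those of two upper or two lower blocks by commutativity, and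
  those of an upper and a lower block by their commutator.\<close>

lemma gl2n_action_bracket:
  "gl2n_action (gl_bracket M N) a
    = gl2n_action M (gl2n_action N a) - gl2n_action N (gl2n_action M a)"
proof -
  define A B C D A' B' C' D'
    where defs: "A = block_ul M" "B = block_ur M" "C = block_ll M" "D = block_lr M"
      "A' = block_ul N" "B' = block_ur N" "C' = block_ll N" "D' = block_lr N"
  have M: "gl2n_action M v = U_of A * v - v * U_of D + upper_act B v + lower_act C v"
    and N: "gl2n_action N v = U_of A' * v - v * U_of D' + upper_act B' v + lower_act C' v" for v
    by (simp_all add: gl2n_action_blocks defs)
  have MN: "gl2n_action (gl_bracket M N) a
     = U_of (gl_bracket A A' + (B ** C' - B' ** C)) * a
     - a * U_of (C ** B' - C' ** B + gl_bracket D D')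
     + upper_act (A ** B' + B ** D' - A' ** B - B' ** D) a
     + lower_act (C ** A' + D ** C' - C' ** A - D' ** C) a"
    by (simp add: gl2n_action_blocks block_bracket defs)
  have 1: "upper_act B (lower_act C' a) = lower_act C' (upper_act B a)
      + U_of (B ** C') * a + a * U_of (C' ** B)"
    and 2: "upper_act B' (lower_act C a) = lower_act C (upper_act B' a)
      + U_of (B' ** C) * a + a * U_of (C ** B')"
    using upper_lower_act_commutator[of B C' a] upper_lower_act_commutator[of B' C a]
    by (simp_all add: algebra_simps)
  show ?thesis
    unfolding MN M N
    by (simp add: upper_act_linear lower_act_linear act_diff act_matrix_diff U_of_add U_of_diff
        U_of_bracket upper_act_mult_left upper_act_mult_right lower_act_mult_left
        lower_act_mult_right upper_act_commute[of B B'] lower_act_commute[of C C'] 1 2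
        algebra_simps)
qed

lemma vector_space_matrix_scale: "vector_space (\<lambda>c. map_matrix ((*) (c::complex)))"
  by unfold_locales (simp_all add: vec_eq_iff algebra_simps)

theorem theorem17:
  shows "gl_module U_scale
    (gl2n_action :: complex^('n + 'n)^('n + 'n) \<Rightarrow> 'n::finite U_gl \<Rightarrow> 'n U_gl)"
  unfolding gl_module_def
proof (intro conjI allI)
  fix M N :: "complex^('n + 'n)^('n + 'n)" and a :: "'n U_gl"
  show "vector_space (U_scale :: _ \<Rightarrow> 'n U_gl \<Rightarrow> _)"
    by (rule vector_space_U_scale)
  show "Vector_Spaces.linear (\<lambda>c. map_matrix ((*) c)) U_scale (\<lambda>X. gl2n_action X a)"
    and "Vector_Spaces.linear U_scale U_scale (gl2n_action M)"
    by (simp_all add: module_hom_def module_hom_axioms_def module_iff_vector_space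
        vector_space_matrix_scale vector_space_U_scale gl2n_action_linear
        flip: module_hom_iff_linear)
  show "gl2n_action (gl_bracket M N) a
      = gl2n_action M (gl2n_action N a) - gl2n_action N (gl2n_action M a)"
    by (rule gl2n_action_bracket)
qed

end
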